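(* Let $d,L\ge 1$ and $n\ge 0$ be integers. Let $\alpha\in\Lambda_{d,L}$ be a cylindric shape, let $\mathbf{x}=(x_1,x_2,\dots,x_d)\in\Delta_{d,L}$ where $x_i=\alpha_{i-1}-\alpha_i$ for $i\in[d]$, and let $u=0^{x_1}10^{x_2}1\cdots 0^{x_d}1$. There are explicit bijections between the following sets: (a) The set $\mathrm{SCT}^n_{d,L}(\cdot/\alpha)$ of standard cylindric tableaux of period $(d,L)$ with $n$ cells and inner shape $\alpha$. (b) The set $\mathcal{W}^n_{d,L}(\mathbf{x})$ of $n$-step walks in $\mathcal{D}_{d,L}$ starting at vertex $\mathbf{x}$. (c) The set of $n$-step walks in $\mathcal{E}_{d,L}$ starting at state $u$. (d) The set of $n$-step walks in $\mathcal{N}_{d,L}$ starting at state $[\![u]\!]$.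
   Context: Notation: $[d]=\{1,\dots,d\}$, $\mathbb{N}$ is the set of nonnegative integers; in strings, exponents denote repetition. Cylindric shapes and tableaux. The cylinder is $\mathcal{C}_{d,L}=\mathbb{Z}^2/(-d,L)\mathbb{Z}$; its elements (cells) are classes $\langle i,j\rangle=(i,j)+(-d,L)\mathbb{Z}$, where $i$ is the row and $j$ the column. A cylindric shape of period $(d,L)$ is a doubly infinite weakly decreasing integer sequence $\lambda=(\lambda_i)_{i\in\mathbb{Z}}$ with $\lambda_i=\lambda_{i+d}+L$ for all $i$; it is determined by $[\lambda_1,\dots,\lambda_d]$. $\Lambda_{d,L}$ is the set of these. Its Young diagram is $Y_\lambda=\{\langle i,j\rangle: j\le\lambda_i\}$. Write $\mu\subseteq\lambda$ if $\mu_i\le\lambda_i$ for all $i$; then $Y_{\lambda/\mu}=Y_\lambda\setminus Y_\mu=\{\langle i,j\rangle:\mu_i<j\le\lambda_i\}$, with cardinality $|\lambda/\mu|=\sum_{i=1}^d(\lambda_i-\mu_i)$. A standard cylindric tableau of period $(d,L)$ and shape $\lambda/\mu$ (outer shape $\lambda$, inner shape $\mu$, with $|\lambda/\mu|$ cells) is a filling of the cells of $Y_{\lambda/\mu}$ with $1,2,\dots,|\lambda/\mu|$, each used exactly once, with entries increasing along rows (from $\langle i,j\rangle$ to $\langle i,j+1\rangle$) and along columns (from $\langle i,j\rangle$ to $\langle i+1,j\rangle$). $\mathrm{SCT}^n_{d,L}(\cdot/\alpha)$ is the set of those with $n$ cells and inner shape $\alpha$ (arbitrary outer shape). Simplices.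 $\Delta_{d,L}=\{(x_1,\dots,x_d)\in\mathbb{N}^d: x_1+\cdots+x_d=L\}$. With $e_i$ the unit coordinate vectors and $e_{d+1}=e_1$, let $s_i=e_{i+1}-e_i$ for $i\in[d]$. $\mathcal{D}_{d,L}$ is the directed graph with vertex set $\Delta_{d,L}$ and an edge from $\mathbf{x}$ to $\mathbf{y}$ (labeled $s_i$) whenever $\mathbf{y}-\mathbf{x}=s_i$ for some $i\in[d]$. Exclusion process (TASEP). Let $N=d+L$. $\mathcal{E}_{d,L}$ is the directed graph whose vertices (states) are the binary strings $u_1\cdots u_N$ with exactly $d$ ones, with indices modulo $N$, and with an edge from $u$ to $v$ iff there is $r$ such that $u_{r-1}u_r=01$, $v_{r-1}v_r=10$, and $u_t=v_t$ for all $t\in\mathbb{Z}_N\setminus\{r-1,r\}$. $\mathcal{N}_{d,L}$ is the directed multigraph whose vertices are the necklaces $[\![u]\!]$, i.e. equivalence classes of states under cyclic rotation; the number of edges from $[\![u]\!]$ to $[\![v]\!]$ is the number of $\tilde v\in[\![v]\!]$ such that $\mathcal{E}_{d,L}$ has an edge from $u$ to $\tilde v$ (independent of the representative $u$). A walk in a directed (multi)graph is a sequence of consecutive edges, each traversed in its forward direction; parallel edges are distinguished. *)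

theory Defs
  imports
    "HOL-Library.FuncSet"
    "HOL-Library.List_Lexorder"
    "Graph_Theory.Graph_Theory"
begin

section \<open>Cylindric shapes and tableaux\<close>

type_synonym cell = "(int \<times> int) set"

definition cell :: "nat \<Rightarrow> nat \<Rightarrow> int \<Rightarrow> int \<Rightarrow> cell" where
  "cell d L i j = {(i - k * int d, j + k * int L) | k :: int. True}"

definition cylindric_shapes :: "nat \<Rightarrow> nat \<Rightarrow> (int \<Rightarrow> int) set" where
  "cylindric_shapes d L = {lam. antimono lam \<and> (\<forall>i. lam i = lam (i + int d) + int L)}"

definition young_diagram :: "nat \<Rightarrow> nat \<Rightarrow> (int \<Rightarrow> int) \<Rightarrow> cell set" where
  "young_diagram d L lam = {cell d L i j | i j. j \<le> lam i}"

definition skew_diagram :: "nat \<Rightarrow> nat \<Rightarrow> (int \<Rightarrow> int) \<Rightarrow> (int \<Rightarrow> int) \<Rightarrow> cell set" where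
  "skew_diagram d L lam mu = young_diagram d L lam - young_diagram d L mu"

text \<open>Fillings are functions on cells; being extensional makes two fillings equal as soon as
  they agree on the cells of the skew diagram.\<close>

definition standard_filling ::
  "nat \<Rightarrow> nat \<Rightarrow> (int \<Rightarrow> int) \<Rightarrow> (int \<Rightarrow> int) \<Rightarrow> (cell \<Rightarrow> nat) \<Rightarrow> bool" where
  "standard_filling d L lam mu T \<longleftrightarrow>
     (let Y = skew_diagram d L lam mu in
       T \<in> extensional Y \<and> bij_betw T Y {1..card Y} \<and>
       (\<forall>i j. cell d L i j \<in> Y \<longrightarrow> cell d L i (j + 1) \<in> Y \<longrightarrow>
          T (cell d L i j) < T (cell d L i (j + 1))) \<and>
       (\<forall>i j. cell d L i j \<in> Y \<longrightarrow> cell d L (i + 1) j \<in> Y \<longrightarrow>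
          T (cell d L i j) < T (cell d L (i + 1) j)))"

text \<open>A tableau is a pair of its outer shape and its filling.\<close>

definition SCT ::
  "nat \<Rightarrow> nat \<Rightarrow> nat \<Rightarrow> (int \<Rightarrow> int) \<Rightarrow> ((int \<Rightarrow> int) \<times> (cell \<Rightarrow> nat)) set" where
  "SCT d L n \<alpha> = {(lam, T). lam \<in> cylindric_shapes d L \<and> (\<forall>i. \<alpha> i \<le> lam i) \<and>
     card (skew_diagram d L lam \<alpha>) = n \<and> standard_filling d L lam \<alpha> T}"


section \<open>Walks\<close>

text \<open>Walks are lists of arcs, so parallel arcs are distinguished.\<close>

definition walks :: "('a, 'b) pre_digraph \<Rightarrow> nat \<Rightarrow> 'a \<Rightarrow> 'b list set" where
  "walks G n a = {p. length p = n \<and> (\<exists>b. pre_digraph.awalk G a p b)}"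


section \<open>Walks in simplices\<close>

text \<open>Lists are indexed from 0: the entry \<open>x ! i\<close> stands for the coordinate $x_{i+1}$, and the
  index \<open>i < d\<close> stands for the step $s_{i+1}$.\<close>

definition simplex :: "nat \<Rightarrow> nat \<Rightarrow> nat list set" where
  "simplex d L = {x. length x = d \<and> sum_list x = L}"

text \<open>For \<open>d = 1\<close> the only step is the zero vector.\<close>

definition simplex_step :: "nat \<Rightarrow> nat \<Rightarrow> nat \<Rightarrow> int" where
  "simplex_step d i k = of_bool (k = Suc i mod d) - of_bool (k = i)"

text \<open>An arc \<open>(x, i, y)\<close> goes from \<open>x\<close> to \<open>y\<close> and carries the label \<open>i\<close>.\<close>

definition simplex_digraph :: "nat \<Rightarrow> nat \<Rightarrow> (nat list, nat list \<times> nat \<times> nat list) pre_digraph" where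
  "simplex_digraph d L =
     \<lparr> verts = simplex d L,
       arcs = {(x, i, y). x \<in> simplex d L \<and> y \<in> simplex d L \<and> i < d \<and>
                 (\<forall>k<d. int (y ! k) - int (x ! k) = simplex_step d i k)},
       tail = (\<lambda>(x, i, y). x),
       head = (\<lambda>(x, i, y). y) \<rparr>"


section \<open>The exclusion process\<close>

text \<open>Binary strings are lists of booleans, \<open>True\<close> being the digit 1; positions are counted
  from 0.\<close>

definition states :: "nat \<Rightarrow> nat \<Rightarrow> bool list set" where
  "states d L = {u. length u = d + L \<and> count_list u True = d}"

definition tasep_move :: "bool list \<Rightarrow> bool list \<Rightarrow> bool" where
  "tasep_move u v \<longleftrightarrow>
     length v = length u \<and>
     (\<exists>r<length u. let r' = Suc r mod length u in
        \<not> u ! r \<and> u ! r' \<and> v ! r \<and> \<not> v ! r' \<and>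
        (\<forall>t<length u. t \<notin> {r, r'} \<longrightarrow> u ! t = v ! t))"

definition tasep_digraph :: "nat \<Rightarrow> nat \<Rightarrow> (bool list, bool list \<times> bool list) pre_digraph" where
  "tasep_digraph d L =
     \<lparr> verts = states d L,
       arcs = {(u, v). u \<in> states d L \<and> v \<in> states d L \<and> tasep_move u v},
       tail = fst,
       head = snd \<rparr>"

definition simplex_word :: "nat list \<Rightarrow> bool list" where
  "simplex_word x = concat (map (\<lambda>m. replicate m False @ [True]) x)"

definition necklace :: "bool list \<Rightarrow> bool list set" where
  "necklace u = range (\<lambda>k. rotate k u)"

text \<open>An arc with tail \<open>c\<close> is recorded as \<open>(c, v)\<close>, where \<open>v\<close> is a state reached in one move from
  the lexicographically least representative \<open>Min c\<close>. The lemma \<open>card_necklace_arcs\<close> below shows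
  that the multiplicities are those obtained from any representative.\<close>

definition necklace_digraph ::
  "nat \<Rightarrow> nat \<Rightarrow> (bool list set, bool list set \<times> bool list) pre_digraph" where
  "necklace_digraph d L =
     \<lparr> verts = necklace ` states d L,
       arcs = {(c, v). c \<in> necklace ` states d L \<and> (Min c, v) \<in> arcs (tasep_digraph d L)},
       tail = fst,
       head = (\<lambda>(c, v). necklace v) \<rparr>"

lemma finite_necklace: "finite (necklace u)"
proof (rule finite_subset)
  show "necklace u \<subseteq> {v. set v \<subseteq> set u \<and> length v = length u}"
    by (auto simp: necklace_def)
  show "finite {v. set v \<subseteq> set u \<and> length v = length u}"
    by (rule finite_lists_length_eq) simp
qed

lemma Min_necklace: "\<exists>k. Min (necklace u) = rotate k u"
  using Min_in[OF finite_necklace, of u] by (auto simp: necklace_def)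

lemma rotate_inverse:
  assumes "length v = N" shows "rotate (N * k - k) (rotate k v) = v"
proof (cases "N = 0")
  case False
  then have "N * k - k + k = length v * k" using assms by (cases N) auto
  then show ?thesis
    by (simp add: rotate_rotate rotate_id)
qed (use assms in simp)

lemma necklace_rotate: "necklace (rotate k u) = necklace u"
proof -
  obtain m where m: "rotate m (rotate k u) = u"
    using rotate_inverse[of u "length u" k] by blast
  have "rotate j u \<in> necklace (rotate k u)" for j
  proof -
    have "rotate j u = rotate (j + m) (rotate k u)" using m by (simp flip: rotate_rotate)
    then show ?thesis by (auto simp: necklace_def)
  qed
  then show ?thesis by (auto simp: necklace_def rotate_rotate)
qed

lemma tasep_move_rotate:
  assumes "tasep_move u v" shows "tasep_move (rotate k u) (rotate k v)"
proof (induction k)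
  case (Suc k)
  let ?a = "rotate k u" and ?b = "rotate k v" and ?N = "length u"
  from Suc obtain r where r: "r < ?N" and len: "length ?b = ?N"
    and h: "\<not> ?a ! r" "?a ! (Suc r mod ?N)" "?b ! r" "\<not> ?b ! (Suc r mod ?N)"
      "\<forall>t<?N. t \<notin> {r, Suc r mod ?N} \<longrightarrow> ?a ! t = ?b ! t"
    by (auto simp: tasep_move_def Let_def)
  obtain q where q: "q < ?N" "Suc q mod ?N = r"
  proof (cases r)
    case 0
    with r that[of "?N - 1"] show ?thesis by simp
  next
    case (Suc r')
    with r that[of r'] show ?thesis by simp
  qed
  have n: "rotate1 ?a ! t = ?a ! (Suc t mod ?N)" "rotate1 ?b ! t = ?b ! (Suc t mod ?N)"
    if "t < ?N" for t
    using that len nth_rotate1[of t ?a] nth_rotate1[of t ?b] by auto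
  have inj: "Suc t mod ?N = Suc s mod ?N \<longleftrightarrow> t = s" if "t < ?N" "s < ?N" for s t
    using that by (auto simp: mod_Suc split: if_splits)
  have rN: "r < ?N" "Suc q mod ?N < ?N" "Suc t mod ?N < ?N" for t
    using r q by (simp_all add: mod_less_divisor[OF le_less_trans[OF le0 r]])
  have "tasep_move (rotate1 ?a) (rotate1 ?b)"
    unfolding tasep_move_def Let_def
  proof (intro conjI exI[of _ q])
    show "length (rotate1 ?b) = length (rotate1 ?a)" using len by simp
    show "q < length (rotate1 ?a)" using q by simp
    show "\<not> rotate1 ?a ! q" "rotate1 ?a ! (Suc q mod length (rotate1 ?a))"
      "rotate1 ?b ! q" "\<not> rotate1 ?b ! (Suc q mod length (rotate1 ?a))"
      using h q r by (simp_all add: n)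
    show "\<forall>t<length (rotate1 ?a). t \<notin> {q, Suc q mod length (rotate1 ?a)} \<longrightarrow>
        rotate1 ?a ! t = rotate1 ?b ! t"
    proof (intro allI impI)
      fix t assume "t < length (rotate1 ?a)" "t \<notin> {q, Suc q mod length (rotate1 ?a)}"
      then have t: "t < ?N" "t \<noteq> q" "t \<noteq> r" using q by auto
      then have "Suc t mod ?N \<notin> {r, Suc r mod ?N}"
        using inj[of t q] inj[of t r] q r by auto
      then show "rotate1 ?a ! t = rotate1 ?b ! t" using h(5) rN n t by auto
    qed
  qed
  then show ?case by simp
qed (use assms in simp)

lemma count_list_rotate: "count_list (rotate k u) a = count_list u a"
proof (induction k)
  case (Suc k)
  have "count_list (rotate1 w) a = count_list w a" for w by (cases w) simp_all
  with Suc show ?case by simp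
qed simp

lemma tasep_arc_rotate:
  assumes "(u, v) \<in> arcs (tasep_digraph d L)"
  shows "(rotate k u, rotate k v) \<in> arcs (tasep_digraph d L)"
  using assms
  by (simp add: tasep_digraph_def states_def count_list_rotate tasep_move_rotate)

lemma card_necklace_arcs:
  assumes u: "u \<in> states d L"
  shows "card {e \<in> arcs (necklace_digraph d L).
             tail (necklace_digraph d L) e = necklace u \<and>
             head (necklace_digraph d L) e = necklace v}
       = card {v' \<in> necklace v. (u, v') \<in> arcs (tasep_digraph d L)}"
    (is "card ?A = card ?B")
proof -
  obtain k where k: "Min (necklace u) = rotate k u" using Min_necklace by blast
  obtain m where m: "rotate m (rotate k w) = w" if "length w = d + L" for w :: "bool list"
    using rotate_inverse[of _ "d + L" k] by blast
  obtain m' where m': "rotate m' (rotate m w) = w" if "length w = d + L" for w :: "bool list"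
    using rotate_inverse[of _ "d + L" m] by blast
  have km: "rotate k (rotate m w) = w" if "length w = d + L" for w :: "bool list"
    using m[of "rotate m w"] m'[of w] m'[of "rotate k (rotate m w)"] that by simp
  have len: "length b = d + L" if "(a, b) \<in> arcs (tasep_digraph d L)" for a b
    using that by (simp add: tasep_digraph_def states_def)
  have self: "w \<in> necklace w" for w
    unfolding necklace_def by (rule range_eqI[of _ _ 0]) simp
  have "bij_betw (\<lambda>w. (necklace u, rotate k w)) ?B ?A"
  proof (rule bij_betw_byWitness[where f' = "\<lambda>e. rotate m (snd e)"])
    show "\<forall>w\<in>?B. rotate m (snd (necklace u, rotate k w)) = w" using len m by auto
    show "\<forall>e\<in>?A. (necklace u, rotate k (rotate m (snd e))) = e"
      using len km by (auto simp: necklace_digraph_def)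
    have "necklace w = necklace v" if "w \<in> necklace v" for w
      using that necklace_rotate[of _ v] by (force simp: necklace_def)
    then show "(\<lambda>w. (necklace u, rotate k w)) ` ?B \<subseteq> ?A"
      using u tasep_arc_rotate[of u _ d L k]
      by (auto simp: necklace_digraph_def k necklace_rotate)
    show "(\<lambda>e. rotate m (snd e)) ` ?A \<subseteq> ?B"
    proof (clarsimp simp: necklace_digraph_def k)
      fix w assume w: "(rotate k u, w) \<in> arcs (tasep_digraph d L)" "necklace w = necklace v"
      have "rotate m w \<in> necklace v" using self[of "rotate m w"] w(2) by (simp add: necklace_rotate)
      moreover have "(u, rotate m w) \<in> arcs (tasep_digraph d L)"
        using tasep_arc_rotate[OF w(1), of m] m[of u] u by (simp add: states_def)
      ultimately show "rotate m w \<in> necklace v \<and> (u, rotate m w) \<in> arcs (tasep_digraph d L)" ..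
    qed
  qed
  then show ?thesis by (simp add: bij_betw_same_card)
qed


section \<open>The bijections\<close>

text \<open>The entry \<open>k\<close> of a tableau gives the \<open>k\<close>-th label of a walk in the simplex, namely the row
  containing \<open>k\<close>. The rows $1, \dots, d$ correspond to the labels \<open>0, \<dots>, d - 1\<close>.\<close>

definition entry_row ::
  "nat \<Rightarrow> nat \<Rightarrow> (int \<Rightarrow> int) \<Rightarrow> (int \<Rightarrow> int) \<times> (cell \<Rightarrow> nat) \<Rightarrow> nat \<Rightarrow> nat" where
  "entry_row d L \<alpha> = (\<lambda>(lam, T) k. THE i. i < d \<and>
     (\<exists>j. cell d L (int i + 1) j \<in> skew_diagram d L lam \<alpha> \<and> T (cell d L (int i + 1) j) = k))"

definition apply_step :: "nat \<Rightarrow> nat list \<Rightarrow> nat \<Rightarrow> nat list" where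
  "apply_step d x i = map (\<lambda>k. nat (int (x ! k) + simplex_step d i k)) [0..<d]"

primrec walk_of_labels :: "nat \<Rightarrow> nat list \<Rightarrow> nat list \<Rightarrow> (nat list \<times> nat \<times> nat list) list" where
  "walk_of_labels d x [] = []"
| "walk_of_labels d x (i # is) =
     (x, i, apply_step d x i) # walk_of_labels d (apply_step d x i) is"

definition tableau_to_simplex_walk ::
  "nat \<Rightarrow> nat \<Rightarrow> nat \<Rightarrow> (int \<Rightarrow> int) \<Rightarrow> nat list \<Rightarrow> (int \<Rightarrow> int) \<times> (cell \<Rightarrow> nat) \<Rightarrow>
     (nat list \<times> nat \<times> nat list) list" where
  "tableau_to_simplex_walk d L n \<alpha> x T = walk_of_labels d x (map (entry_row d L \<alpha> T) [1..<Suc n])"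

text \<open>A step $s_i$ lets the $i$-th particle jump left. For $i < d$ this turns the word of \<open>x\<close> into
  the word of \<open>y\<close>; for $i = d$ the first 0 of the word of \<open>y\<close> is moved to its end. The state is
  therefore the word of the current vertex, rotated by the number \<open>s\<close> of steps $s_d$ so far.\<close>

primrec simplex_to_tasep_walk ::
  "nat \<Rightarrow> nat \<Rightarrow> (nat list \<times> nat \<times> nat list) list \<Rightarrow> (bool list \<times> bool list) list" where
  "simplex_to_tasep_walk d s [] = []"
| "simplex_to_tasep_walk d s (e # p) =
     (case e of (x, i, y) \<Rightarrow>
       let s' = (if Suc i = d then Suc s else s) in
         (rotate s (simplex_word x), rotate s' (simplex_word y)) # simplex_to_tasep_walk d s' p)"

text \<open>The projection to necklaces: a move is rotated so that it starts at the chosen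
  representative of its necklace.\<close>

definition tasep_to_necklace_arc :: "bool list \<times> bool list \<Rightarrow> bool list set \<times> bool list" where
  "tasep_to_necklace_arc = (\<lambda>(u, v).
     (necklace u, rotate (LEAST k. rotate k u = Min (necklace u)) v))"

end

theory Submission
  imports Defs
begin

text \<open>All four sets grow in the same way when \<open>n\<close> increases by one, and each of the three maps
  respects this growth; so each is a bijection by induction on \<open>n\<close>. An object of size \<open>n + 1\<close> is a
  first step followed by an object of size \<open>n\<close> over a new starting point.

  For walks this is the removal of the first arc (\<open>walks_Suc\<close>). A map between walks that acts arc by
  arc is therefore bijective as soon as it is bijective on the arcs leaving any given vertex
  (\<open>bij_betw_walks_Suc\<close>). For the projection to necklaces this holds because the moves are
  equivariant under rotation. For the map from the simplex to the exclusion process, write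
  \<open>x = xs @ Suc m # ys\<close> with \<open>i = length xs\<close>. The word of \<open>x\<close> then contains the factor 01 right in front of
  the word of \<open>ys\<close>, and the step with label \<open>i\<close> turns this factor into 10. Every factor 01 of the
  word arises once in this way, since each binary string is uniquely the word of some list followed
  by zeros (\<open>bij_betw_jump\<close>).

  For tableaux the first step is the cell that contains 1. Nothing precedes this cell in its row
  or column, so it is the first cell to the right of \<open>\<alpha>\<close> in some row \<open>i + 1\<close> with
  \<open>\<alpha> (i + 1) < \<alpha> i\<close>, that is, with \<open>x ! i > 0\<close>. Adding it to the inner shape and lowering all other
  entries by 1 leaves a tableau of size \<open>n\<close>, and the operation is reversible (\<open>SCT_Suc_cases\<close>,
  \<open>insert_one_SCT\<close>). The differences of the new inner shape are the coordinates of the next vertex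
  of the walk (\<open>apply_step_add_cell\<close>), so the recursion is that of the walks in the simplex.\<close>

section \<open>Walks\<close>

lemma walks_0: "walks G 0 a = (if a \<in> verts G then {[]} else {})"
  by (auto simp: walks_def pre_digraph.awalk_def pre_digraph.cas.simps)

lemma walks_Suc:
  assumes "wf_digraph G"
  shows "walks G (Suc n) a = (\<lambda>(e, p). e # p) ` (SIGMA e:out_arcs G a. walks G n (head G e))"
proof -
  interpret wf_digraph G by fact
  show ?thesis
    by (force simp: walks_def awalk_def length_Suc_conv)
qed

text \<open>The first steps are indexed by an arbitrary set \<open>A\<close>, not by arcs of a second digraph, so that the
  lemma also covers tableaux, which come with a recursion but not as walks.\<close>

lemma bij_betw_Cons_walks:
  assumes "wf_digraph H"
    and f: "bij_betw f A (out_arcs H b)"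
    and g: "\<And>a. a \<in> A \<Longrightarrow> bij_betw (g a) (C a) (walks H n (head H (f a)))"
  shows "bij_betw (\<lambda>(a, c). f a # g a c) (Sigma A C) (walks H (Suc n) b)"
proof (rule bij_betw_imageI)
  show "inj_on (\<lambda>(a, c). f a # g a c) (Sigma A C)"
    using f bij_betw_imp_inj_on[OF g] by (auto intro!: inj_onI dest: bij_betw_imp_inj_on inj_onD)
  have im: "walks H n (head H (f a)) = g a ` C a" if "a \<in> A" for a
    using g[OF that] by (simp add: bij_betw_def)
  have "out_arcs H b = f ` A" using f by (simp add: bij_betw_def)
  then have "walks H (Suc n) b = (\<Union>a\<in>A. (#) (f a) ` walks H n (head H (f a)))"
    by (auto simp: walks_Suc[OF assms(1)])
  also have "\<dots> = (\<Union>a\<in>A. (#) (f a) ` g a ` C a)"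
    using im by simp
  also have "\<dots> = (\<lambda>(a, c). f a # g a c) ` Sigma A C"
    by force
  finally show "(\<lambda>(a, c). f a # g a c) ` Sigma A C = walks H (Suc n) b" ..
qed

text \<open>Here \<open>g\<close> assembles an object from its parts and \<open>h\<close> is \<open>f\<close> expressed on the parts. If \<open>f\<close> agrees
  on two objects, then \<open>h\<close> agrees on their parts, so the parts and hence the objects coincide.\<close>

lemma bij_betw_cancel_surj:
  assumes "bij_betw h A C" and "g ` A = B" and "\<And>a. a \<in> A \<Longrightarrow> f (g a) = h a"
  shows "bij_betw f B C"
proof (rule bij_betw_imageI)
  show "inj_on f B"
    using assms(1,3) unfolding assms(2)[symmetric] bij_betw_def inj_on_def by auto
  show "f ` B = C"
    using assms(1,3) unfolding assms(2)[symmetric] bij_betw_def by (simp add: image_image)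
qed

lemma bij_betw_walks_Suc:
  assumes G: "wf_digraph G" and H: "wf_digraph H"
    and f: "bij_betw f (out_arcs G a) (out_arcs H b)"
    and g: "\<And>e. e \<in> out_arcs G a \<Longrightarrow>
      bij_betw (g e) (walks G n (head G e)) (walks H n (head H (f e)))"
    and F: "\<And>e p. e \<in> out_arcs G a \<Longrightarrow> F (e # p) = f e # g e p"
  shows "bij_betw F (walks G (Suc n) a) (walks H (Suc n) b)"
proof (rule bij_betw_cancel_surj)
  show "bij_betw (\<lambda>(e, p). f e # g e p) (SIGMA e:out_arcs G a. walks G n (head G e))
      (walks H (Suc n) b)"
    using H f g by (rule bij_betw_Cons_walks)
  show "(\<lambda>(e, p). e # p) ` (SIGMA e:out_arcs G a. walks G n (head G e)) = walks G (Suc n) a"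
    using walks_Suc[OF G] by simp
qed (use F in auto)

lemma wf_simplex: "wf_digraph (simplex_digraph d L)"
  by unfold_locales (auto simp: simplex_digraph_def)

lemma wf_tasep: "wf_digraph (tasep_digraph d L)"
  by unfold_locales (auto simp: tasep_digraph_def)

lemma wf_necklace: "wf_digraph (necklace_digraph d L)"
  by unfold_locales (auto simp: necklace_digraph_def tasep_digraph_def)

section \<open>Rotations and necklaces\<close>

lemma rotate_back: "\<exists>m. \<forall>v. length v = N \<longrightarrow> rotate m (rotate k v) = v \<and> rotate k (rotate m v) = v"
proof (intro exI allI impI conjI)
  fix v :: "'a list"
  assume v: "length v = N"
  then show *: "rotate (N * k - k) (rotate k v) = v" by (rule rotate_inverse)
  have "rotate k (rotate (N * k - k) v) = rotate (N * k - k) (rotate k v)"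
    unfolding rotate_rotate by (subst add.commute) (rule refl)
  with * show "rotate k (rotate (N * k - k) v) = v" by simp
qed

lemma length_arc:
  assumes "(a, b) \<in> arcs (tasep_digraph d L)"
  shows "length a = d + L" "length b = d + L" "a \<in> states d L" "b \<in> states d L"
  using assms by (auto simp: tasep_digraph_def states_def)

lemma out_arcs_tasep:
  "out_arcs (tasep_digraph d L) u = Pair u ` {v. (u, v) \<in> arcs (tasep_digraph d L)}"
  by (auto simp: out_arcs_def tasep_digraph_def)

lemma tasep_arcs_rotate:
  "(rotate k u, v) \<in> arcs (tasep_digraph d L) \<longleftrightarrow>
    v \<in> rotate k ` {v. (u, v) \<in> arcs (tasep_digraph d L)}"
proof -
  obtain m where
    m: "\<And>v :: bool list. length v = d + L \<Longrightarrow> rotate m (rotate k v) = v \<and> rotate k (rotate m v) = v"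
    using rotate_back by blast
  show ?thesis
  proof
    assume a: "(rotate k u, v) \<in> arcs (tasep_digraph d L)"
    then have "(rotate m (rotate k u), rotate m v) \<in> arcs (tasep_digraph d L)"
      by (rule tasep_arc_rotate)
    with m[of u] m[of v] length_arc[OF a] show "v \<in> rotate k ` {v. (u, v) \<in> arcs (tasep_digraph d L)}"
      by (metis image_eqI length_rotate mem_Collect_eq)
  qed (auto intro: tasep_arc_rotate)
qed

lemma inj_rotate: "inj (rotate k)"
  by (rule injI) (metis length_rotate rotate_inverse)

text \<open>The arcs leaving a necklace are the moves from its least representative. Rotating by the
  amount that takes \<open>u\<close> to this representative is a bijection onto them from the moves from \<open>u\<close>.
  The necklace of the target does not change, so the induction hypothesis applies to the target.\<close>

lemma bij_betw_necklace_walks: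
  assumes "u \<in> states d L"
  shows "bij_betw (map tasep_to_necklace_arc) (walks (tasep_digraph d L) n u)
    (walks (necklace_digraph d L) n (necklace u))"
  using assms
proof (induction n arbitrary: u)
  case 0
  then show ?case by (auto simp: walks_0 bij_betw_def tasep_digraph_def necklace_digraph_def)
next
  case (Suc n)
  define k where "k = (LEAST k. rotate k u = Min (necklace u))"
  obtain j where "rotate j u = Min (necklace u)" using Min_necklace[of u] by metis
  then have k: "rotate k u = Min (necklace u)"
    unfolding k_def by (rule LeastI)
  have f: "tasep_to_necklace_arc (u, v) = (necklace u, rotate k v)" for v
    by (simp add: tasep_to_necklace_arc_def k_def)
  show ?case
  proof (rule bij_betw_walks_Suc[OF wf_tasep wf_necklace])
    have "out_arcs (necklace_digraph d L) (necklace u) =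
        Pair (necklace u) ` {v. (rotate k u, v) \<in> arcs (tasep_digraph d L)}"
      using Suc.prems by (auto simp: out_arcs_def necklace_digraph_def k)
    then show "bij_betw tasep_to_necklace_arc (out_arcs (tasep_digraph d L) u)
        (out_arcs (necklace_digraph d L) (necklace u))"
      using inj_rotate[of k]
      by (auto simp: bij_betw_def out_arcs_tasep tasep_arcs_rotate f image_image inj_on_def)
    fix e assume "e \<in> out_arcs (tasep_digraph d L) u"
    then obtain v where e: "e = (u, v)" and v: "(u, v) \<in> arcs (tasep_digraph d L)"
      by (auto simp: out_arcs_def tasep_digraph_def)
    show "bij_betw (map tasep_to_necklace_arc) (walks (tasep_digraph d L) n (head (tasep_digraph d L) e))
        (walks (necklace_digraph d L) n (head (necklace_digraph d L) (tasep_to_necklace_arc e)))"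
      using Suc.IH[OF length_arc(4)[OF v]]
      by (simp add: e f tasep_digraph_def necklace_digraph_def necklace_rotate)
  qed simp
qed

section \<open>Words of the points of the simplex\<close>

lemma simplex_word_simps [simp]:
  "simplex_word [] = []"
  "simplex_word (m # x) = replicate m False @ True # simplex_word x"
  "simplex_word (x @ y) = simplex_word x @ simplex_word y"
  by (simp_all add: simplex_word_def)

lemma count_simplex_word: "count_list (simplex_word x) True = length x"
  by (induction x) (auto simp: count_list_0_iff)

lemma simplex_word_states: "x \<in> simplex d L \<Longrightarrow> simplex_word x \<in> states d L"
proof -
  have "length (simplex_word x) = length x + sum_list x" by (induction x) auto
  then show "x \<in> simplex d L \<Longrightarrow> simplex_word x \<in> states d L"
    by (simp add: simplex_def states_def count_simplex_word)
qed

lemma replicate_False_True_eq_iff: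
  "replicate m False @ True # v = replicate m' False @ True # v' \<longleftrightarrow> m = m' \<and> v = v'"
proof (induction m arbitrary: m')
  case 0 then show ?case by (cases m') auto
next
  case (Suc m) then show ?case by (cases m') auto
qed

lemma simplex_word_inj: "simplex_word x = simplex_word y \<longleftrightarrow> x = y"
proof (induction x arbitrary: y)
  case Nil then show ?case by (cases y) auto
next
  case (Cons m x) then show ?case by (cases y) (auto simp: replicate_False_True_eq_iff)
qed

lemma bool_list_simplex_word: "\<exists>x m. v = simplex_word x @ replicate m False"
proof (induction v)
  case Nil show ?case by (metis append_Nil replicate_0 simplex_word_simps(1))
next
  case (Cons b v)
  then obtain x m where v: "v = simplex_word x @ replicate m False" by blast
  show ?case
  proof (cases b)
    case True
    then have "b # v = simplex_word (0 # x) @ replicate m False" using v by simp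
    then show ?thesis by blast
  next
    case False
    show ?thesis
    proof (cases x)
      case Nil
      then have "b # v = simplex_word [] @ replicate (Suc m) False" using v False by simp
      then show ?thesis by blast
    next
      case (Cons a y)
      then have "b # v = simplex_word (Suc a # y) @ replicate m False" using v False by simp
      then show ?thesis by blast
    qed
  qed
qed

lemma simplex_word_last: "x \<noteq> [] \<Longrightarrow> simplex_word x \<noteq> [] \<and> last (simplex_word x)"
  by (cases x rule: rev_cases) auto

section \<open>Steps in the simplex as jumps of particles\<close>

text \<open>Since \<open>u\<close> ends with a 1, no 0 at its end can be followed cyclically by a 1 at its start; so
  the move happens at two adjacent positions of the list.\<close>

lemma tasep_move_linear:
  assumes "last u"
  shows "tasep_move u v \<longleftrightarrow> (\<exists>a b. u = a @ [False, True] @ b \<and> v = a @ [True, False] @ b)"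
proof
  assume "tasep_move u v"
  then obtain r where r: "r < length u" and len: "length v = length u"
    and h: "\<not> u ! r" "u ! (Suc r mod length u)" "v ! r" "\<not> v ! (Suc r mod length u)"
      "\<And>t. t < length u \<Longrightarrow> t \<noteq> r \<Longrightarrow> t \<noteq> Suc r mod length u \<Longrightarrow> u ! t = v ! t"
    unfolding tasep_move_def Let_def by blast
  have "Suc r \<noteq> length u"
  proof
    assume "Suc r = length u"
    then have "last u = u ! r" using last_conv_nth[of u] by (cases u) auto
    with h(1) assms show False by simp
  qed
  with r have r': "Suc r < length u" by simp
  with h have h': "u ! Suc r" "\<not> v ! Suc r"
    "\<And>t. t < length u \<Longrightarrow> t \<noteq> r \<Longrightarrow> t \<noteq> Suc r \<Longrightarrow> u ! t = v ! t" by auto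
  let ?a = "take r u" and ?b = "drop (Suc (Suc r)) u"
  have "u = ?a @ [False, True] @ ?b"
    using r r' h(1) h'(1) id_take_nth_drop[of r u] Cons_nth_drop_Suc[of "Suc r" u] by simp
  moreover have "take r v = ?a" "drop (Suc (Suc r)) v = ?b"
    using r len h'(3) by (auto intro!: nth_equalityI)
  then have "v = ?a @ [True, False] @ ?b"
    using r r' h(3) h'(2) len id_take_nth_drop[of r v] Cons_nth_drop_Suc[of "Suc r" v] by simp
  ultimately show "\<exists>a b. u = a @ [False, True] @ b \<and> v = a @ [True, False] @ b" by blast
next
  assume "\<exists>a b. u = a @ [False, True] @ b \<and> v = a @ [True, False] @ b"
  then obtain a b where u: "u = a @ [False, True] @ b" and v: "v = a @ [True, False] @ b" by blast
  show "tasep_move u v"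
    unfolding tasep_move_def Let_def
    by (intro conjI exI[of _ "length a"]) (auto simp: u v nth_append nth_Cons split: nat.splits)
qed

lemma apply_step_inner:
  "apply_step (length (xs @ Suc m # y # ys)) (xs @ Suc m # y # ys) (length xs) = xs @ m # Suc y # ys"
  by (intro nth_equalityI)
    (auto simp: apply_step_def simplex_step_def nth_append nth_Cons simp del: upt_Suc split: nat.splits)

text \<open>The last coordinate passes its unit on to the first one. If they coincide, the step is zero.\<close>

lemma apply_step_last:
  "apply_step (length (xs @ [Suc m])) (xs @ [Suc m]) (length xs) =
    (case xs of [] \<Rightarrow> [Suc m] | z # zs \<Rightarrow> Suc z # zs @ [m])"
proof (cases xs)
  case Nil
  then show ?thesis by (simp add: apply_step_def simplex_step_def)
next
  case (Cons z zs)
  have "apply_step (length (z # zs @ [Suc m])) (z # zs @ [Suc m]) (length (z # zs)) = Suc z # zs @ [m]"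
    by (intro nth_equalityI)
      (auto simp: apply_step_def simplex_step_def nth_append nth_Cons split: nat.splits)
  with Cons show ?thesis by simp
qed

lemma split_at_positive:
  assumes "i < length x" "0 < x ! i"
  obtains xs m ys where "x = xs @ Suc m # ys" "length xs = i"
proof (rule that)
  show "x = take i x @ Suc (x ! i - 1) # drop (Suc i) x"
    using id_take_nth_drop[OF assms(1)] assms(2) by simp
  show "length (take i x) = i" using assms(1) by simp
qed

lemma apply_step_simplex:
  assumes "x \<in> simplex d L" "i < d" "0 < x ! i"
  shows "apply_step d x i \<in> simplex d L"
proof -
  have d: "d = length x" using assms(1) by (simp add: simplex_def)
  obtain xs m ys where x: "x = xs @ Suc m # ys" and i: "length xs = i"
    using assms split_at_positive[of i x] unfolding d by metis
  show ?thesis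
  proof (cases ys)
    case Nil
    then show ?thesis
      using assms(1) apply_step_last[of xs m] unfolding d x i[symmetric]
      by (cases xs) (auto simp: simplex_def)
  next
    case (Cons y zs)
    then show ?thesis
      using assms(1) apply_step_inner[of xs m y zs] unfolding d x i[symmetric]
      by (auto simp: simplex_def)
  qed
qed

lemma out_arcs_simplex:
  assumes x: "x \<in> simplex d L" and L: "L \<ge> 1"
  shows "out_arcs (simplex_digraph d L) x = (\<lambda>i. (x, i, apply_step d x i)) ` {i. i < d \<and> 0 < x ! i}"
proof -
  have len: "length x = d" and sum: "sum_list x = L" using x by (auto simp: simplex_def)
  have pos: "0 < x ! i \<and> y = apply_step d x i"
    if y: "y \<in> simplex d L" and i: "i < d" and
      s: "\<forall>k<d. int (y ! k) - int (x ! k) = simplex_step d i k" for i y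
  proof
    \<comment> \<open>For \<open>d = 1\<close> the step is zero and the only vertex is \<open>[L]\<close>; otherwise coordinate \<open>i\<close> drops by 1.\<close>
    show "0 < x ! i"
    proof (cases "d = 1")
      case True
      with len sum L i show ?thesis by (cases x) auto
    next
      case False
      with i have "Suc i mod d \<noteq> i" by (simp add: mod_Suc)
      with s i have "int (y ! i) - int (x ! i) = -1" by (simp add: simplex_step_def)
      then show ?thesis by linarith
    qed
    have "int (x ! k) + simplex_step d i k = int (y ! k)" if "k < d" for k
      using s that by (metis add_diff_cancel_left' add_diff_eq)
    with y show "y = apply_step d x i"
      by (intro nth_equalityI) (auto simp: simplex_def apply_step_def)
  qed
  have "int (apply_step d x i ! k) - int (x ! k) = simplex_step d i k"
    if "i < d" "0 < x ! i" "k < d" for i k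
    using that by (auto simp: apply_step_def simplex_step_def)
  with pos x apply_step_simplex[OF x] show ?thesis
    by (auto simp: out_arcs_def simplex_digraph_def)
qed

text \<open>The state reached from the word of \<open>x\<close> when its particle \<open>i\<close> jumps. Words of points always end
  with a 1, but after a jump of the last particle the string ends with a 0; the rotation by 1 moves
  the leading 0 of the word back to the end.\<close>

definition jump :: "nat \<Rightarrow> nat list \<Rightarrow> nat \<Rightarrow> bool list" where
  "jump d x i = rotate (of_bool (Suc i = d)) (simplex_word (apply_step d x i))"

lemma jump_split:
  assumes "x = xs @ Suc m # ys" "d = length x"
  shows "jump d x (length xs) =
    (simplex_word xs @ replicate m False) @ [True, False] @ simplex_word ys"
proof (cases ys)
  case Nil
  then show ?thesis
    using apply_step_last[of xs m] assms
    by (cases xs) (auto simp: jump_def replicate_append_same)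
next
  case (Cons y zs)
  then show ?thesis
    using apply_step_inner[of xs m y zs] assms by (simp add: jump_def)
qed

text \<open>The words before and after the move differ first at the position \<open>length a\<close>.\<close>

lemma move_unique:
  assumes "a @ [False, True] @ b = a' @ [False, True] @ b'"
    and "a @ [True, False] @ b = a' @ [True, False] @ b'"
  shows "a = a'"
proof (rule ccontr)
  have *: False if "length a < length a'" "a @ [False, True] @ b = a' @ [False, True] @ b'"
    "a @ [True, False] @ b = a' @ [True, False] @ b'" for a b a' b' :: "bool list"
  proof -
    have "a' ! length a = False" "a' ! length a = True"
      using that(1) arg_cong[OF that(2), of "\<lambda>w. w ! length a"]
        arg_cong[OF that(3), of "\<lambda>w. w ! length a"] by (simp_all add: nth_append)
    then show False by simp
  qed
  assume "a \<noteq> a'"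
  then have "length a \<noteq> length a'" using assms(1) by auto
  then consider "length a < length a'" | "length a' < length a" by linarith
  then show False using *[of a a' b b'] *[of a' a b' b] assms by cases simp_all
qed

text \<open>A factor 01 is determined by the number \<open>i\<close> of ones to its left, which gives injectivity. For
  surjectivity, the parts to the left and to the right of a factor 01 are themselves words of lists
  up to trailing zeros, and these pieces exhibit the coordinate that the step lowers.\<close>

lemma bij_betw_jump:
  assumes x: "x \<in> simplex d L"
  shows "bij_betw (jump d x) {i. i < d \<and> 0 < x ! i} {v. (simplex_word x, v) \<in> arcs (tasep_digraph d L)}"
proof -
  have len: "length x = d" using x by (auto simp: simplex_def)
  have word: "simplex_word x \<in> states d L" using x by (rule simplex_word_states)
  have arc: "(simplex_word x, v) \<in> arcs (tasep_digraph d L) \<longleftrightarrow>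
      (\<exists>a b. simplex_word x = a @ [False, True] @ b \<and> v = a @ [True, False] @ b)" for v
  proof (cases "x = []")
    case True
    then show ?thesis
      by (auto simp: tasep_digraph_def tasep_move_def)
  next
    case False
    have "v \<in> states d L"
      if "simplex_word x = a @ [False, True] @ b" "v = a @ [True, False] @ b" for a b
      using word that by (simp add: states_def)
    then show ?thesis
      using word tasep_move_linear[of "simplex_word x" v] simplex_word_last[OF False]
      by (simp add: tasep_digraph_def) blast
  qed
  have ab: "\<exists>a b. simplex_word x = a @ [False, True] @ b \<and> jump d x i = a @ [True, False] @ b \<and>
      count_list a True = i" if i: "i < d" "0 < x ! i" for i
  proof -
    obtain xs m ys where xs: "x = xs @ Suc m # ys" "length xs = i"
      using i split_at_positive[of i x] unfolding len by metis
    show ?thesis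
      using jump_split[OF xs(1), of d] len xs
      by (intro exI[of _ "simplex_word xs @ replicate m False"] exI[of _ "simplex_word ys"])
        (simp add: count_simplex_word count_list_0_iff
          flip: replicate_append_same)
  qed
  show ?thesis
  proof (rule bij_betw_imageI)
    show "inj_on (jump d x) {i. i < d \<and> 0 < x ! i}"
    proof (rule inj_onI)
      fix i j assume *: "i \<in> {i. i < d \<and> 0 < x ! i}" "j \<in> {i. i < d \<and> 0 < x ! i}"
        "jump d x i = jump d x j"
      obtain a b where a: "simplex_word x = a @ [False, True] @ b"
        "jump d x i = a @ [True, False] @ b" "count_list a True = i" using ab * by blast
      obtain a' b' where a': "simplex_word x = a' @ [False, True] @ b'"
        "jump d x j = a' @ [True, False] @ b'" "count_list a' True = j" using ab * by blast
      have "a = a'" using a(1,2) a'(1,2) *(3) by (intro move_unique[of a b a' b']) simp_all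
      with a(3) a'(3) show "i = j" by simp
    qed
    show "jump d x ` {i. i < d \<and> 0 < x ! i} = {v. (simplex_word x, v) \<in> arcs (tasep_digraph d L)}"
    proof (intro equalityI subsetI)
      fix v assume "v \<in> {v. (simplex_word x, v) \<in> arcs (tasep_digraph d L)}"
      then obtain a b where a: "simplex_word x = a @ [False, True] @ b"
        and v: "v = a @ [True, False] @ b" by (auto simp: arc)
      obtain xs m where xs: "a = simplex_word xs @ replicate m False"
        using bool_list_simplex_word by blast
      obtain ys k where ys: "b = simplex_word ys @ replicate k False"
        using bool_list_simplex_word by blast
      have "x \<noteq> []" using a by auto
      then have "last (a @ [False, True] @ b)" using simplex_word_last[of x] a by simp
      \<comment> \<open>The word of \<open>x\<close> ends with a 1, so no zeros trail the word of \<open>ys\<close>.\<close>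
      then have k: "k = 0" using ys by (cases k) (auto simp flip: replicate_append_same)
      have "simplex_word x = simplex_word (xs @ Suc m # ys)"
        using a xs ys k by (simp flip: replicate_append_same)
      then have x_eq: "x = xs @ Suc m # ys" by (simp only: simplex_word_inj)
      have "v = jump d x (length xs)"
        using jump_split[OF x_eq] len v xs ys k by simp
      with x_eq len show "v \<in> jump d x ` {i. i < d \<and> 0 < x ! i}" by auto
    qed (use ab arc in blast)
  qed
qed

text \<open>The statement is made for every accumulated rotation \<open>s\<close>, because a jump of the last particle
  increases it for the rest of the walk.\<close>

lemma bij_betw_tasep_walks:
  assumes "x \<in> simplex d L" and L: "L \<ge> 1"
  shows "bij_betw (simplex_to_tasep_walk d s) (walks (simplex_digraph d L) n x)
    (walks (tasep_digraph d L) n (rotate s (simplex_word x)))"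
  using assms(1)
proof (induction n arbitrary: x s)
  case 0
  then have "rotate s (simplex_word x) \<in> states d L"
    using simplex_word_states[of x d L] by (simp add: states_def count_list_rotate)
  with 0 show ?case by (auto simp: walks_0 bij_betw_def tasep_digraph_def simplex_digraph_def)
next
  case (Suc n)
  define f where "f = (\<lambda>(x :: nat list, i, y).
    (rotate s (simplex_word x), rotate (if Suc i = d then Suc s else s) (simplex_word y)))"
  define J where "J = {i. i < d \<and> 0 < x ! i}"
  have f_jump: "f (x, i, apply_step d x i) = (rotate s (simplex_word x), rotate s (jump d x i))" for i
    by (simp add: f_def jump_def rotate_rotate)
  have arcs: "out_arcs (simplex_digraph d L) x = (\<lambda>i. (x, i, apply_step d x i)) ` J"
    using out_arcs_simplex[OF Suc.prems L] by (simp add: J_def)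
  show ?case
  proof (rule bij_betw_walks_Suc[OF wf_simplex wf_tasep])
    show "bij_betw f (out_arcs (simplex_digraph d L) x)
        (out_arcs (tasep_digraph d L) (rotate s (simplex_word x)))"
    proof (rule bij_betw_cancel_surj)
      have "bij_betw (\<lambda>v. (rotate s (simplex_word x), rotate s v))
          {v. (simplex_word x, v) \<in> arcs (tasep_digraph d L)}
          (out_arcs (tasep_digraph d L) (rotate s (simplex_word x)))"
        using inj_rotate[of s]
        by (auto simp: bij_betw_def inj_on_def out_arcs_tasep tasep_arcs_rotate image_image)
      from bij_betw_trans[OF bij_betw_jump[OF Suc.prems] this]
      show "bij_betw (\<lambda>i. (rotate s (simplex_word x), rotate s (jump d x i))) J
          (out_arcs (tasep_digraph d L) (rotate s (simplex_word x)))"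
        by (simp add: J_def comp_def)
    qed (use arcs f_jump in auto)
    fix e assume "e \<in> out_arcs (simplex_digraph d L) x"
    then obtain i where e: "e = (x, i, apply_step d x i)" and i: "i < d" "0 < x ! i"
      unfolding arcs by (auto simp: J_def)
    show "bij_betw (simplex_to_tasep_walk d (if Suc (fst (snd e)) = d then Suc s else s))
        (walks (simplex_digraph d L) n (head (simplex_digraph d L) e))
        (walks (tasep_digraph d L) n (head (tasep_digraph d L) (f e)))"
      using Suc.IH[OF apply_step_simplex[OF Suc.prems i]]
      by (auto simp: e f_def simplex_digraph_def tasep_digraph_def)
    show "simplex_to_tasep_walk d s (e # p) =
        f e # simplex_to_tasep_walk d (if Suc (fst (snd e)) = d then Suc s else s) p" for p
      by (simp add: e f_def Let_def)
  qed
qed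

section \<open>Cells of the cylinder\<close>

lemma cell_eq_iff:
  "cell d L i j = cell d L i' j' \<longleftrightarrow> (\<exists>k. i' = i - k * int d \<and> j' = j + k * int L)"
proof
  assume "cell d L i j = cell d L i' j'"
  moreover have "(i', j') \<in> cell d L i' j'" unfolding cell_def by (force intro: exI[of _ 0])
  ultimately have "(i', j') \<in> cell d L i j" by simp
  then show "\<exists>k. i' = i - k * int d \<and> j' = j + k * int L" by (auto simp: cell_def)
next
  assume "\<exists>k. i' = i - k * int d \<and> j' = j + k * int L"
  then obtain k where k: "i' = i - k * int d" "j' = j + k * int L" by blast
  show "cell d L i j = cell d L i' j'"
  proof (intro equalityI subsetI)
    fix p assume "p \<in> cell d L i j"
    then obtain m where "p = (i - m * int d, j + m * int L)" by (auto simp: cell_def)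
    then show "p \<in> cell d L i' j'"
      unfolding cell_def k by (auto intro!: exI[of _ "m - k"] simp: algebra_simps)
  next
    fix p assume "p \<in> cell d L i' j'"
    then obtain m where "p = (i' - m * int d, j' + m * int L)" by (auto simp: cell_def)
    then show "p \<in> cell d L i j"
      unfolding cell_def k by (auto intro!: exI[of _ "m + k"] simp: algebra_simps)
  qed
qed

lemma shape_shift:
  assumes "lam \<in> cylindric_shapes d L"
  shows "lam (i - k * int d) = lam i + k * int L"
proof (induction k rule: int_induct[where k = 0])
  case (step1 k)
  have "lam (i - (k + 1) * int d) = lam (i - (k + 1) * int d + int d) + int L"
    using assms unfolding cylindric_shapes_def by blast
  with step1 show ?case by (simp add: algebra_simps)
next
  case (step2 k)
  have "lam (i - k * int d) = lam (i - k * int d + int d) + int L"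
    using assms unfolding cylindric_shapes_def by blast
  with step2 show ?case by (simp add: algebra_simps)
qed simp

lemma shape_antimono: "lam \<in> cylindric_shapes d L \<Longrightarrow> i \<le> j \<Longrightarrow> lam j \<le> lam i"
  unfolding cylindric_shapes_def by (blast dest: antimonoD)

text \<open>Membership of a cell can be tested on any of its representatives, as shapes have the period of
  the cylinder.\<close>

lemma cell_in_young_diagram:
  assumes "lam \<in> cylindric_shapes d L"
  shows "cell d L i j \<in> young_diagram d L lam \<longleftrightarrow> j \<le> lam i"
proof
  assume "cell d L i j \<in> young_diagram d L lam"
  then show "j \<le> lam i"
    by (auto simp: young_diagram_def cell_eq_iff shape_shift[OF assms])
next
  assume "j \<le> lam i"
  then show "cell d L i j \<in> young_diagram d L lam"
    unfolding young_diagram_def by blast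
qed

lemma cell_in_skew_diagram:
  assumes "lam \<in> cylindric_shapes d L" "mu \<in> cylindric_shapes d L"
  shows "cell d L i j \<in> skew_diagram d L lam mu \<longleftrightarrow> mu i < j \<and> j \<le> lam i"
  unfolding skew_diagram_def by (auto simp: cell_in_young_diagram assms)

lemma skew_diagram_cellE:
  assumes "c \<in> skew_diagram d L lam mu"
  obtains i j where "c = cell d L i j"
  using assms by (auto simp: skew_diagram_def young_diagram_def)

lemma cell_row_representative:
  assumes "d \<ge> 1"
  obtains i' j' where "i' < d" "cell d L i j = cell d L (int i' + 1) j'"
proof (rule that)
  have nn: "0 \<le> (i - 1) mod int d" "(i - 1) mod int d < int d" using assms by simp_all
  then show "nat ((i - 1) mod int d) < d" by linarith
  have "(i - 1) mod int d + 1 = i - (i - 1) div int d * int d"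
    using div_mult_mod_eq[of "i - 1" "int d"] by linarith
  with nn show "cell d L i j =
      cell d L (int (nat ((i - 1) mod int d)) + 1) (j + (i - 1) div int d * int L)"
    by (auto simp: cell_eq_iff)
qed

lemma cell_row_unique:
  assumes "cell d L (int i + 1) j = cell d L (int i' + 1) j'" "i < d" "i' < d"
  shows "i = i'"
proof -
  obtain k where k: "int i' = int i - k * int d" using assms(1) by (auto simp: cell_eq_iff)
  then have "int i' mod int d = int i mod int d" by (simp add: mod_eq_dvd_iff)
  with assms show ?thesis by simp
qed

lemma mod_eq_shiftE:
  fixes r r' m :: int
  assumes "r mod m = r' mod m"
  obtains k where "r = r' - k * m"
proof -
  from assms have "m dvd r' - r" by (metis mod_eq_dvd_iff)
  then obtain k where "r' - r = m * k" by (rule dvdE)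
  then have "r = r' - k * m" by (simp add: algebra_simps)
  then show ?thesis by (rule that)
qed

section \<open>Tableaux\<close>

text \<open>The size condition is absorbed into the bijection onto
  \<open>{1..n}\<close>; this also excludes infinite diagrams, whose cardinality is 0 by convention.\<close>

lemma SCT_iff:
  assumes "\<alpha> \<in> cylindric_shapes d L"
  shows "(lam, T) \<in> SCT d L n \<alpha> \<longleftrightarrow>
    lam \<in> cylindric_shapes d L \<and> (\<forall>i. \<alpha> i \<le> lam i) \<and>
    T \<in> extensional (skew_diagram d L lam \<alpha>) \<and>
    bij_betw T (skew_diagram d L lam \<alpha>) {1..n} \<and>
    (\<forall>i j. \<alpha> i < j \<and> j < lam i \<longrightarrow> T (cell d L i j) < T (cell d L i (j + 1))) \<and>
    (\<forall>i j. \<alpha> i < j \<and> j \<le> lam (i + 1) \<longrightarrow> T (cell d L i j) < T (cell d L (i + 1) j))"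
proof (cases "lam \<in> cylindric_shapes d L \<and> (\<forall>i. \<alpha> i \<le> lam i)")
  case True
  then have lam: "lam \<in> cylindric_shapes d L" by blast
  have "(\<alpha> i < j \<and> j \<le> lam i \<longrightarrow> \<alpha> i < j + 1 \<and> j + 1 \<le> lam i \<longrightarrow> P) \<longleftrightarrow>
      (\<alpha> i < j \<and> j < lam i \<longrightarrow> P)" for i j P by auto
  moreover have "(\<alpha> i < j \<and> j \<le> lam i \<longrightarrow> \<alpha> (i + 1) < j \<and> j \<le> lam (i + 1) \<longrightarrow> P) \<longleftrightarrow>
      (\<alpha> i < j \<and> j \<le> lam (i + 1) \<longrightarrow> P)" for i j P
    using shape_antimono[OF lam, of i "i + 1"] shape_antimono[OF assms, of i "i + 1"] by auto
  moreover have "card (skew_diagram d L lam \<alpha>) = n"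
    if "bij_betw T (skew_diagram d L lam \<alpha>) {1..n}" using bij_betw_same_card[OF that] by simp
  ultimately show ?thesis
    using True by (auto simp: SCT_def standard_filling_def Let_def cell_in_skew_diagram[OF lam assms])
next
  case False
  then show ?thesis by (simp only: SCT_def mem_Collect_eq prod.case) blast
qed

lemma SCT_0:
  assumes "\<alpha> \<in> cylindric_shapes d L"
  shows "SCT d L 0 \<alpha> = {(\<alpha>, \<lambda>_. undefined)}"
proof -
  have "lam = \<alpha> \<and> T = (\<lambda>_. undefined)" if t: "(lam, T) \<in> SCT d L 0 \<alpha>" for lam T
  proof -
    have lam: "lam \<in> cylindric_shapes d L" and le: "\<And>i. \<alpha> i \<le> lam i"
      and T: "T \<in> extensional (skew_diagram d L lam \<alpha>)"
      and bij: "bij_betw T (skew_diagram d L lam \<alpha>) {1..0}"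
      using t unfolding SCT_iff[OF assms] by blast+
    from bij have empty: "skew_diagram d L lam \<alpha> = {}" by (simp add: bij_betw_def)
    have "lam i \<le> \<alpha> i" for i
      using cell_in_skew_diagram[OF lam assms, of i "lam i"] empty by auto
    with le have "lam = \<alpha>" by (intro ext antisym)
    moreover have "T = (\<lambda>_. undefined)" using T empty by (auto simp: extensional_def)
    ultimately show ?thesis ..
  qed
  moreover have "(\<alpha>, \<lambda>_. undefined) \<in> SCT d L 0 \<alpha>"
  proof -
    have "\<not> (\<alpha> i < j \<and> j \<le> \<alpha> (i + 1))" for i j
      using shape_antimono[OF assms, of i "i + 1"] by simp
    moreover have "skew_diagram d L \<alpha> \<alpha> = {}" by (simp add: skew_diagram_def)
    ultimately show ?thesis
      unfolding SCT_iff[OF assms] using assms by (simp add: bij_betw_def extensional_def)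
  qed
  ultimately show ?thesis by (intro equalityI subsetI) (metis prod.exhaust insertI1 singletonD)+
qed

definition add_cell :: "nat \<Rightarrow> (int \<Rightarrow> int) \<Rightarrow> nat \<Rightarrow> int \<Rightarrow> int" where
  "add_cell d \<alpha> i r = \<alpha> r + of_bool (r mod int d = (int i + 1) mod int d)"

text \<open>The cell by which the Young diagrams of \<open>\<alpha>\<close> and \<open>add_cell d \<alpha> i\<close> differ.\<close>

definition corner :: "nat \<Rightarrow> nat \<Rightarrow> (int \<Rightarrow> int) \<Rightarrow> nat \<Rightarrow> cell" where
  "corner d L \<alpha> i = cell d L (int i + 1) (\<alpha> (int i + 1) + 1)"

lemma cell_eq_corner:
  assumes "\<alpha> \<in> cylindric_shapes d L"
  shows "cell d L r j = corner d L \<alpha> i \<longleftrightarrow> r mod int d = (int i + 1) mod int d \<and> j = \<alpha> r + 1"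
proof
  assume "cell d L r j = corner d L \<alpha> i"
  then obtain k where k: "int i + 1 = r - k * int d" "\<alpha> (int i + 1) + 1 = j + k * int L"
    unfolding corner_def cell_eq_iff by blast
  then have "j = \<alpha> r + 1" using shape_shift[OF assms, of r k] by simp
  moreover have "(r - k * int d) mod int d = r mod int d" by (simp add: mod_eq_dvd_iff)
  ultimately show "r mod int d = (int i + 1) mod int d \<and> j = \<alpha> r + 1" unfolding k(1) by simp
next
  assume r: "r mod int d = (int i + 1) mod int d \<and> j = \<alpha> r + 1"
  then obtain k where "int i + 1 = r - k * int d" by (metis mod_eq_shiftE)
  moreover from this have "\<alpha> (int i + 1) + 1 = j + k * int L"
    using shape_shift[OF assms, of r k] r by simp
  ultimately show "cell d L r j = corner d L \<alpha> i"
    unfolding corner_def cell_eq_iff by blast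
qed

text \<open>By periodicity, if a cell can be added in row \<open>i + 1\<close>, then one can be added in every row
  congruent to it.\<close>

lemma addable_shift:
  assumes "\<alpha> \<in> cylindric_shapes d L" "\<alpha> (int i + 1) < \<alpha> (int i)"
    "r mod int d = (int i + 1) mod int d"
  shows "\<alpha> r < \<alpha> (r - 1)"
proof -
  obtain k where k: "r = int i + 1 - k * int d" using assms(3) by (rule mod_eq_shiftE)
  then have "r - 1 = int i - k * int d" by simp
  then have "\<alpha> (r - 1) = \<alpha> (int i) + k * int L" using shape_shift[OF assms(1)] by simp
  moreover have "\<alpha> r = \<alpha> (int i + 1) + k * int L" unfolding k by (rule shape_shift[OF assms(1)])
  ultimately show ?thesis using assms(2) by simp
qed

lemma add_cell_shape:
  assumes "\<alpha> \<in> cylindric_shapes d L" "\<alpha> (int i + 1) < \<alpha> (int i)"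
  shows "add_cell d \<alpha> i \<in> cylindric_shapes d L"
proof -
  have "add_cell d \<alpha> i s \<le> add_cell d \<alpha> i r" if "r \<le> s" for r s
  proof (cases "s mod int d = (int i + 1) mod int d \<and> r \<noteq> s")
    case True
    with that have "\<alpha> (s - 1) \<le> \<alpha> r" by (intro shape_antimono[OF assms(1)]) simp
    moreover have "\<alpha> s < \<alpha> (s - 1)" using True assms by (blast intro: addable_shift)
    ultimately show ?thesis by (simp add: add_cell_def)
  next
    case False
    with shape_antimono[OF assms(1) that] show ?thesis by (auto simp: add_cell_def)
  qed
  moreover have "add_cell d \<alpha> i r = add_cell d \<alpha> i (r + int d) + int L" for r
  proof -
    have "\<alpha> r = \<alpha> (r + int d) + int L" using assms(1) unfolding cylindric_shapes_def by blast
    then show ?thesis by (simp add: add_cell_def)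
  qed
  ultimately show ?thesis unfolding cylindric_shapes_def antimono_def by blast
qed

lemma skew_diagram_add_cell:
  assumes \<alpha>: "\<alpha> \<in> cylindric_shapes d L" and add: "\<alpha> (int i + 1) < \<alpha> (int i)"
    and lam: "lam \<in> cylindric_shapes d L" and le: "\<forall>r. add_cell d \<alpha> i r \<le> lam r"
  shows "skew_diagram d L lam \<alpha> = insert (corner d L \<alpha> i) (skew_diagram d L lam (add_cell d \<alpha> i))"
    and "corner d L \<alpha> i \<notin> skew_diagram d L lam (add_cell d \<alpha> i)"
proof -
  note in_skew = cell_in_skew_diagram[OF lam \<alpha>] cell_in_skew_diagram[OF lam add_cell_shape[OF \<alpha> add]]
  have *: "cell d L r j \<in> skew_diagram d L lam \<alpha> \<longleftrightarrow>
      cell d L r j = corner d L \<alpha> i \<or> cell d L r j \<in> skew_diagram d L lam (add_cell d \<alpha> i)" for r j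
    using le[THEN spec, of r] by (auto simp: in_skew cell_eq_corner[OF \<alpha>] add_cell_def)
  show "corner d L \<alpha> i \<notin> skew_diagram d L lam (add_cell d \<alpha> i)"
    unfolding corner_def in_skew by (simp add: add_cell_def)
  have "c \<in> skew_diagram d L lam \<alpha> \<longleftrightarrow>
      c = corner d L \<alpha> i \<or> c \<in> skew_diagram d L lam (add_cell d \<alpha> i)" for c
    using * by (metis corner_def skew_diagram_cellE)
  then show "skew_diagram d L lam \<alpha> =
      insert (corner d L \<alpha> i) (skew_diagram d L lam (add_cell d \<alpha> i))" by blast
qed

definition insert_one ::
  "nat \<Rightarrow> nat \<Rightarrow> (int \<Rightarrow> int) \<Rightarrow> nat \<Rightarrow> (int \<Rightarrow> int) \<times> (cell \<Rightarrow> nat) \<Rightarrow> (int \<Rightarrow> int) \<times> (cell \<Rightarrow> nat)" where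
  "insert_one d L \<alpha> i = (\<lambda>(lam, T). (lam, \<lambda>c. if c = corner d L \<alpha> i then 1
     else if c \<in> skew_diagram d L lam \<alpha> then Suc (T c) else undefined))"

text \<open>The new entry 1 is the least one, so only its position as a successor could break the order.
  But its left neighbour lies in the inner shape, and so does its upper neighbour because the corner
  is addable.\<close>

lemma insert_one_SCT:
  assumes \<alpha>: "\<alpha> \<in> cylindric_shapes d L" and add: "\<alpha> (int i + 1) < \<alpha> (int i)"
    and t: "t \<in> SCT d L n (add_cell d \<alpha> i)"
  shows "insert_one d L \<alpha> i t \<in> SCT d L (Suc n) \<alpha>"
proof -
  obtain lam T where t_eq: "t = (lam, T)" by (cases t)
  let ?Y = "skew_diagram d L lam \<alpha>" and ?Y' = "skew_diagram d L lam (add_cell d \<alpha> i)"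
  let ?c = "corner d L \<alpha> i"
  have \<alpha>': "add_cell d \<alpha> i \<in> cylindric_shapes d L" using \<alpha> add by (rule add_cell_shape)
  have lam: "lam \<in> cylindric_shapes d L" and le: "\<forall>r. add_cell d \<alpha> i r \<le> lam r"
    and bij: "bij_betw T ?Y' {1..n}"
    and row: "\<And>r j. add_cell d \<alpha> i r < j \<Longrightarrow> j < lam r \<Longrightarrow> T (cell d L r j) < T (cell d L r (j + 1))"
    and col: "\<And>r j. add_cell d \<alpha> i r < j \<Longrightarrow> j \<le> lam (r + 1) \<Longrightarrow>
      T (cell d L r j) < T (cell d L (r + 1) j)"
    using t unfolding t_eq SCT_iff[OF \<alpha>'] by blast+
  note Y = skew_diagram_add_cell[OF \<alpha> add lam le]
  note in_Y = cell_in_skew_diagram[OF lam \<alpha>]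
  define T' where "T' = (\<lambda>c. if c = ?c then 1 else if c \<in> ?Y then Suc (T c) else undefined)"
  have T': "T' c = Suc (T c)" if "c \<in> ?Y" "c \<noteq> ?c" for c using that by (simp add: T'_def)
  have T'_c: "T' ?c = 1" by (simp add: T'_def)
  have pos: "1 < T' c" if "c \<in> ?Y" "c \<noteq> ?c" for c
    using that Y(1) bij T'[OF that] by (force simp: bij_betw_def)
  have ge: "\<alpha> r \<le> add_cell d \<alpha> i r" for r by (simp add: add_cell_def)
  have strict: "add_cell d \<alpha> i r < j" if "\<alpha> r < j" "cell d L r j \<noteq> ?c" for r j
    using that by (auto simp: cell_eq_corner[OF \<alpha>] add_cell_def)
  have "bij_betw T' ?Y {1..Suc n}"
  proof -
    have "bij_betw (Suc \<circ> T) ?Y' {Suc 1..Suc n}"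
      using bij by (rule bij_betw_trans) (simp add: bij_betw_def image_Suc_atLeastAtMost)
    then have "bij_betw T' ?Y' {Suc 1..Suc n}"
      using Y T' by (subst bij_betw_cong[of _ _ "Suc \<circ> T"]) auto
    moreover have "bij_betw T' {?c} {1}" by (simp add: bij_betw_def T'_c)
    ultimately have "bij_betw T' ({?c} \<union> ?Y') ({1} \<union> {Suc 1..Suc n})"
      by (intro bij_betw_combine) auto
    moreover have "{1} \<union> {Suc 1..Suc n} = {1..Suc n}" by auto
    ultimately show ?thesis using Y(1) by simp
  qed
  moreover have "T' (cell d L r j) < T' (cell d L r (j + 1))" if "\<alpha> r < j" "j < lam r" for r j
  proof -
    have next_ne: "cell d L r (j + 1) \<noteq> ?c" using that by (simp add: cell_eq_corner[OF \<alpha>])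
    have mem: "cell d L r j \<in> ?Y" "cell d L r (j + 1) \<in> ?Y" using that by (simp_all add: in_Y)
    show ?thesis
    proof (cases "cell d L r j = ?c")
      case True
      then show ?thesis using pos[OF mem(2) next_ne] T'_c by simp
    next
      case False
      then show ?thesis using row[OF strict[OF that(1) False] that(2)] T' mem next_ne by simp
    qed
  qed
  moreover have "T' (cell d L r j) < T' (cell d L (r + 1) j)" if "\<alpha> r < j" "j \<le> lam (r + 1)" for r j
  proof -
    have next_ne: "cell d L (r + 1) j \<noteq> ?c"
      using that addable_shift[OF \<alpha> add, of "r + 1"] by (auto simp: cell_eq_corner[OF \<alpha>])
    have mem: "cell d L r j \<in> ?Y" "cell d L (r + 1) j \<in> ?Y"
      using that shape_antimono[OF lam, of r "r + 1"] shape_antimono[OF \<alpha>, of r "r + 1"]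
      by (simp_all add: in_Y)
    show ?thesis
    proof (cases "cell d L r j = ?c")
      case True
      then show ?thesis using pos[OF mem(2) next_ne] T'_c by simp
    next
      case False
      then show ?thesis using col[OF strict[OF that(1) False] that(2)] T' mem next_ne by simp
    qed
  qed
  moreover have "T' \<in> extensional ?Y" using Y(1) by (auto simp: extensional_def T'_def)
  moreover have "\<forall>r. \<alpha> r \<le> lam r" using le ge order_trans by blast
  ultimately have "(lam, T') \<in> SCT d L (Suc n) \<alpha>" using lam by (simp add: SCT_iff[OF \<alpha>])
  then show ?thesis by (simp add: t_eq insert_one_def T'_def)
qed

text \<open>The cell with entry 1 has no predecessor in the skew diagram. A gap between it and the inner
  shape would put a smaller entry to its left; if the row above were not longer in the inner shape,
  a smaller entry would lie above it.\<close>

lemma SCT_Suc_cases: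
  assumes d: "d \<ge> 1" and \<alpha>: "\<alpha> \<in> cylindric_shapes d L" and t: "t \<in> SCT d L (Suc n) \<alpha>"
  obtains i t' where "i < d" "\<alpha> (int i + 1) < \<alpha> (int i)" "t' \<in> SCT d L n (add_cell d \<alpha> i)"
    "t = insert_one d L \<alpha> i t'"
proof -
  obtain lam T where t_eq: "t = (lam, T)" by (cases t)
  let ?Y = "skew_diagram d L lam \<alpha>"
  have lam: "lam \<in> cylindric_shapes d L" and le: "\<And>r. \<alpha> r \<le> lam r"
    and ext: "T \<in> extensional ?Y" and bij: "bij_betw T ?Y {1..Suc n}"
    and row: "\<And>r j. \<alpha> r < j \<Longrightarrow> j < lam r \<Longrightarrow> T (cell d L r j) < T (cell d L r (j + 1))"
    and col: "\<And>r j. \<alpha> r < j \<Longrightarrow> j \<le> lam (r + 1) \<Longrightarrow> T (cell d L r j) < T (cell d L (r + 1) j)"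
    using t unfolding t_eq SCT_iff[OF \<alpha>] by blast+
  note in_Y = cell_in_skew_diagram[OF lam \<alpha>]
  have pos: "1 \<le> T c" if "c \<in> ?Y" for c using bij that by (force simp: bij_betw_def)
  have "1 \<in> T ` ?Y" using bij by (simp add: bij_betw_def)
  then obtain c where c: "c \<in> ?Y" "T c = 1" by auto
  obtain r0 j0 where "c = cell d L r0 j0" using c(1) by (rule skew_diagram_cellE)
  then obtain i j where i: "i < d" and c_eq: "c = cell d L (int i + 1) j"
    using cell_row_representative[OF d, of L r0 j0] by metis
  have j: "\<alpha> (int i + 1) < j" "j \<le> lam (int i + 1)" using c(1) by (simp_all add: c_eq in_Y)
  have j_eq: "j = \<alpha> (int i + 1) + 1"
  proof (rule ccontr)
    assume "j \<noteq> \<alpha> (int i + 1) + 1"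
    with j have *: "\<alpha> (int i + 1) < j - 1" "j - 1 < lam (int i + 1)" by auto
    then have "cell d L (int i + 1) (j - 1) \<in> ?Y" by (simp add: in_Y)
    with pos row[OF *] c(2) show False by (fastforce simp: c_eq)
  qed
  have add: "\<alpha> (int i + 1) < \<alpha> (int i)"
  proof (rule ccontr)
    assume "\<not> \<alpha> (int i + 1) < \<alpha> (int i)"
    then have *: "\<alpha> (int i) < j" using j by simp
    have "j \<le> lam (int i)" using j(2) shape_antimono[OF lam, of "int i" "int i + 1"] by simp
    with * have "cell d L (int i) j \<in> ?Y" by (simp add: in_Y)
    with pos col[OF * j(2)] c(2) show False by (fastforce simp: c_eq)
  qed
  let ?\<alpha>' = "add_cell d \<alpha> i"
  let ?Y' = "skew_diagram d L lam ?\<alpha>'"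
  have c_corner: "c = corner d L \<alpha> i" by (simp add: c_eq j_eq corner_def)
  have \<alpha>': "?\<alpha>' \<in> cylindric_shapes d L" using \<alpha> add by (rule add_cell_shape)
  have le': "\<forall>r. ?\<alpha>' r \<le> lam r"
  proof
    fix r
    show "?\<alpha>' r \<le> lam r"
    proof (cases "r mod int d = (int i + 1) mod int d")
      case True
      then have "cell d L r (\<alpha> r + 1) = c" by (simp add: c_corner cell_eq_corner[OF \<alpha>])
      with c(1) have "\<alpha> r + 1 \<le> lam r" using in_Y by blast
      with True show ?thesis by (simp add: add_cell_def)
    next
      case False
      with le show ?thesis by (simp add: add_cell_def)
    qed
  qed
  note Y = skew_diagram_add_cell[OF \<alpha> add lam le', folded c_corner]
  have ge: "\<alpha> r \<le> ?\<alpha>' r" for r by (simp add: add_cell_def)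
  define T' where "T' = (\<lambda>c. if c \<in> ?Y' then T c - 1 else undefined)"
  have T': "T c = Suc (T' c)" if "c \<in> ?Y'" for c using pos[of c] that Y(1) by (simp add: T'_def)
  have in_Y': "cell d L r j \<in> ?Y'" if "?\<alpha>' r < j" "j \<le> lam r" for r j
    using that by (simp add: cell_in_skew_diagram[OF lam \<alpha>'])
  have "(lam, T') \<in> SCT d L n ?\<alpha>'"
    unfolding SCT_iff[OF \<alpha>']
  proof (intro conjI allI impI)
    show "bij_betw T' ?Y' {1..n}"
    proof -
      have "bij_betw T ?Y' ({1..Suc n} - {1})"
        using bij_betw_DiffI[OF bij, of "{c}" "{1}"] Y c by (simp add: bij_betw_def insert_Diff_if)
      moreover have "{1..Suc n} - {1} = {Suc 1..Suc n}" by auto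
      moreover have "bij_betw (\<lambda>k. k - 1) {Suc 1..Suc n} {1..n}"
        by (rule bij_betw_byWitness[where f' = Suc]) auto
      ultimately have "bij_betw ((\<lambda>k. k - 1) \<circ> T) ?Y' {1..n}" by (metis bij_betw_trans)
      then show ?thesis by (subst bij_betw_cong[of _ _ "(\<lambda>k. k - 1) \<circ> T"]) (auto simp: T'_def)
    qed
    fix r j
    show "T' (cell d L r j) < T' (cell d L r (j + 1))" if *: "?\<alpha>' r < j \<and> j < lam r"
      using row[of r j] * ge[of r] T'[OF in_Y', of r j] T'[OF in_Y', of r "j + 1"] by simp
    show "T' (cell d L r j) < T' (cell d L (r + 1) j)" if *: "?\<alpha>' r < j \<and> j \<le> lam (r + 1)"
      using col[of r j] * ge[of r] T'[OF in_Y', of r j] T'[OF in_Y', of "r + 1" j]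
        shape_antimono[OF lam, of r "r + 1"] shape_antimono[OF \<alpha>', of r "r + 1"] by simp
    show "lam \<in> cylindric_shapes d L" "?\<alpha>' r \<le> lam r" for r using lam le' by simp_all
    show "T' \<in> extensional ?Y'" by (simp add: T'_def extensional_def)
  qed
  moreover have "t = insert_one d L \<alpha> i (lam, T')"
    using c T' Y ext by (auto simp: t_eq insert_one_def extensional_def simp flip: c_corner)
  ultimately show ?thesis using that i add by blast
qed

lemma entry_row_eq:
  assumes "bij_betw T (skew_diagram d L lam \<alpha>) {1..n}"
    and "cell d L (int i + 1) j \<in> skew_diagram d L lam \<alpha>" "i < d"
  shows "entry_row d L \<alpha> (lam, T) (T (cell d L (int i + 1) j)) = i"
  unfolding entry_row_def prod.case
proof (rule the_equality)
  fix i'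
  assume "i' < d \<and> (\<exists>j'. cell d L (int i' + 1) j' \<in> skew_diagram d L lam \<alpha> \<and>
      T (cell d L (int i' + 1) j') = T (cell d L (int i + 1) j))"
  then obtain j' where "i' < d" "cell d L (int i' + 1) j' = cell d L (int i + 1) j"
    using assms bij_betw_imp_inj_on[OF assms(1)] by (auto dest: inj_onD)
  then show "i' = i" using cell_row_unique assms(3) by blast
next
  show "i < d \<and> (\<exists>j'. cell d L (int i + 1) j' \<in> skew_diagram d L lam \<alpha> \<and>
      T (cell d L (int i + 1) j') = T (cell d L (int i + 1) j))"
    by (intro conjI exI[of _ j] assms(2,3) refl)
qed

text \<open>The row sequence of the extended tableau is \<open>i\<close> followed by that of the original one: the exact
  analogue of prefixing a walk with an arc labelled \<open>i\<close>.\<close>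

lemma entry_row_insert_one:
  assumes d: "d \<ge> 1" and \<alpha>: "\<alpha> \<in> cylindric_shapes d L" and i: "i < d"
    and add: "\<alpha> (int i + 1) < \<alpha> (int i)" and t: "t \<in> SCT d L n (add_cell d \<alpha> i)"
  shows "entry_row d L \<alpha> (insert_one d L \<alpha> i t) 1 = i"
    and "k \<in> {1..n} \<Longrightarrow>
      entry_row d L \<alpha> (insert_one d L \<alpha> i t) (Suc k) = entry_row d L (add_cell d \<alpha> i) t k"
proof -
  obtain lam T where t_eq: "t = (lam, T)" by (cases t)
  have \<alpha>': "add_cell d \<alpha> i \<in> cylindric_shapes d L" using \<alpha> add by (rule add_cell_shape)
  have lam: "lam \<in> cylindric_shapes d L" and le: "\<forall>r. add_cell d \<alpha> i r \<le> lam r"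
    and bij: "bij_betw T (skew_diagram d L lam (add_cell d \<alpha> i)) {1..n}"
    using t unfolding t_eq SCT_iff[OF \<alpha>'] by blast+
  note Y = skew_diagram_add_cell[OF \<alpha> add lam le]
  obtain T' where T': "insert_one d L \<alpha> i t = (lam, T')"
    and corner: "T' (corner d L \<alpha> i) = 1"
    and other: "\<And>c. c \<in> skew_diagram d L lam (add_cell d \<alpha> i) \<Longrightarrow> T' c = Suc (T c)"
    using Y by (fastforce simp: t_eq insert_one_def)
  have bij': "bij_betw T' (skew_diagram d L lam \<alpha>) {1..Suc n}"
    using insert_one_SCT[OF \<alpha> add t] by (simp add: T' SCT_iff[OF \<alpha>])
  show "entry_row d L \<alpha> (insert_one d L \<alpha> i t) 1 = i"
    using entry_row_eq[OF bij' _ i, of "\<alpha> (int i + 1) + 1"] Y(1) corner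
    by (simp add: T' corner_def)
  assume "k \<in> {1..n}"
  then have "k \<in> T ` skew_diagram d L lam (add_cell d \<alpha> i)" using bij by (simp add: bij_betw_def)
  then obtain c where c: "c \<in> skew_diagram d L lam (add_cell d \<alpha> i)" "T c = k" by blast
  obtain r0 j0 where "c = cell d L r0 j0" using c(1) by (rule skew_diagram_cellE)
  then obtain i' j' where i': "i' < d" "c = cell d L (int i' + 1) j'"
    using cell_row_representative[OF d, of L r0 j0] by metis
  have "entry_row d L \<alpha> (lam, T') (Suc k) = i'"
    using entry_row_eq[OF bij' _ i'(1), of j'] other[OF c(1)] c Y(1) i'(2) by simp
  moreover have "entry_row d L (add_cell d \<alpha> i) (lam, T) k = i'"
    using entry_row_eq[OF bij _ i'(1), of j'] c i'(2) by simp
  ultimately show "entry_row d L \<alpha> (insert_one d L \<alpha> i t) (Suc k) =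
      entry_row d L (add_cell d \<alpha> i) t k"
    unfolding T' by (simp add: t_eq)
qed

text \<open>Adding a cell in row \<open>i + 1\<close> lowers the difference to the row above and raises the difference to the
  row below; since rows are counted modulo \<open>d\<close>, this is the step with label \<open>i\<close>.\<close>

lemma apply_step_add_cell:
  assumes \<alpha>: "\<alpha> \<in> cylindric_shapes d L" and add: "\<alpha> (int i + 1) < \<alpha> (int i)" and i: "i < d"
    and x: "\<forall>k<d. int (x ! k) = \<alpha> (int k) - \<alpha> (int k + 1)" and k: "k < d"
  shows "int (apply_step d x i ! k) = add_cell d \<alpha> i (int k) - add_cell d \<alpha> i (int k + 1)"
proof -
  have "int k mod int d = (int i + 1) mod int d \<longleftrightarrow> k = Suc i mod d"
    using k by (metis mod_less of_nat_Suc of_nat_eq_iff zmod_int add.commute)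
  moreover have "(int k + 1) mod int d = (int i + 1) mod int d \<longleftrightarrow> int k mod int d = int i mod int d"
    by (simp add: mod_eq_dvd_iff)
  then have "(int k + 1) mod int d = (int i + 1) mod int d \<longleftrightarrow> k = i" using k i by simp
  ultimately have *: "simplex_step d i k =
      (add_cell d \<alpha> i (int k) - add_cell d \<alpha> i (int k + 1)) - (\<alpha> (int k) - \<alpha> (int k + 1))"
    by (simp add: simplex_step_def add_cell_def)
  have "add_cell d \<alpha> i (int k + 1) \<le> add_cell d \<alpha> i (int k)"
    using add_cell_shape[OF \<alpha> add] by (rule shape_antimono) simp
  with * k x show ?thesis by (simp add: apply_step_def)
qed

lemma bij_betw_simplex_walks:
  assumes d: "d \<ge> 1" and L: "L \<ge> 1"
    and "\<alpha> \<in> cylindric_shapes d L" and "x \<in> simplex d L"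
    and "\<forall>i<d. int (x ! i) = \<alpha> (int i) - \<alpha> (int i + 1)"
  shows "bij_betw (tableau_to_simplex_walk d L n \<alpha> x) (SCT d L n \<alpha>)
    (walks (simplex_digraph d L) n x)"
  using assms(3-5)
proof (induction n arbitrary: \<alpha> x)
  case 0
  then show ?case
    by (simp add: SCT_0 walks_0 simplex_digraph_def tableau_to_simplex_walk_def bij_betw_def)
next
  case (Suc n)
  note \<alpha> = Suc.prems(1) and x = Suc.prems(2,3)
  define A where "A = {i. i < d \<and> 0 < x ! i}"
  have A: "i \<in> A \<longleftrightarrow> i < d \<and> \<alpha> (int i + 1) < \<alpha> (int i)" for i
    using x(2) by (auto simp: A_def)
  define g where "g i = tableau_to_simplex_walk d L n (add_cell d \<alpha> i) (apply_step d x i)" for i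
  show ?case
  proof (rule bij_betw_cancel_surj)
    show "bij_betw (\<lambda>(i, t). (x, i, apply_step d x i) # g i t)
        (SIGMA i:A. SCT d L n (add_cell d \<alpha> i)) (walks (simplex_digraph d L) (Suc n) x)"
    proof (rule bij_betw_Cons_walks[OF wf_simplex])
      show "bij_betw (\<lambda>i. (x, i, apply_step d x i)) A (out_arcs (simplex_digraph d L) x)"
        unfolding out_arcs_simplex[OF x(1) L] A_def by (auto simp: bij_betw_def inj_on_def)
      fix i assume "i \<in> A"
      then have i: "i < d" "0 < x ! i" "\<alpha> (int i + 1) < \<alpha> (int i)" using A A_def by auto
      show "bij_betw (g i) (SCT d L n (add_cell d \<alpha> i)) (walks (simplex_digraph d L) n
          (head (simplex_digraph d L) (x, i, apply_step d x i)))"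
        using Suc.IH[OF add_cell_shape[OF \<alpha> i(3)] apply_step_simplex[OF x(1) i(1,2)]]
          apply_step_add_cell[OF \<alpha> i(3) i(1) x(2)]
        by (simp add: g_def simplex_digraph_def)
    qed
    show "(\<lambda>(i, t). insert_one d L \<alpha> i t) ` (SIGMA i:A. SCT d L n (add_cell d \<alpha> i)) =
        SCT d L (Suc n) \<alpha>"
    proof (intro equalityI subsetI)
      fix t assume "t \<in> SCT d L (Suc n) \<alpha>"
      then obtain i t' where "i < d" "\<alpha> (int i + 1) < \<alpha> (int i)"
        "t' \<in> SCT d L n (add_cell d \<alpha> i)" "t = insert_one d L \<alpha> i t'"
        by (rule SCT_Suc_cases[OF d \<alpha>])
      then show "t \<in> (\<lambda>(i, t). insert_one d L \<alpha> i t) ` (SIGMA i:A. SCT d L n (add_cell d \<alpha> i))"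
        by (intro image_eqI[of _ _ "(i, t')"]) (simp_all add: A)
    next
      fix t assume "t \<in> (\<lambda>(i, t). insert_one d L \<alpha> i t) ` (SIGMA i:A. SCT d L n (add_cell d \<alpha> i))"
      then obtain i t' where "i \<in> A" "t' \<in> SCT d L n (add_cell d \<alpha> i)" "t = insert_one d L \<alpha> i t'"
        by auto
      then show "t \<in> SCT d L (Suc n) \<alpha>" using insert_one_SCT[OF \<alpha>] A by simp
    qed
    fix p assume "p \<in> (SIGMA i:A. SCT d L n (add_cell d \<alpha> i))"
    then obtain i t where p: "p = (i, t)" and i: "i < d" "\<alpha> (int i + 1) < \<alpha> (int i)"
      and t: "t \<in> SCT d L n (add_cell d \<alpha> i)" using A by auto
    let ?e = "entry_row d L \<alpha> (insert_one d L \<alpha> i t)"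
    have "[1..<Suc (Suc n)] = 1 # map Suc [1..<Suc n]"
      unfolding map_Suc_upt by (subst upt_conv_Cons) simp_all
    then have "map ?e [1..<Suc (Suc n)] = ?e 1 # map (\<lambda>k. ?e (Suc k)) [1..<Suc n]"
      by (simp add: comp_def del: upt_Suc)
    also have "?e 1 = i"
      by (rule entry_row_insert_one(1)[OF d \<alpha> i t])
    also have "map (\<lambda>k. ?e (Suc k)) [1..<Suc n] = map (entry_row d L (add_cell d \<alpha> i) t) [1..<Suc n]"
      by (rule map_cong[OF refl], rule entry_row_insert_one(2)[OF d \<alpha> i t]) (simp del: upt_Suc)
    finally show "tableau_to_simplex_walk d L (Suc n) \<alpha> x (case p of (i, t) \<Rightarrow> insert_one d L \<alpha> i t) =
        (case p of (i, t) \<Rightarrow> (x, i, apply_step d x i) # g i t)"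
      by (simp add: p g_def tableau_to_simplex_walk_def del: upt_Suc)
  qed
qed

section \<open>The three bijections\<close>

theorem theorem3p8:
  fixes d L n :: nat and \<alpha> :: "int \<Rightarrow> int" and x :: "nat list" and u :: "bool list"
  assumes "d \<ge> 1" and "L \<ge> 1"
    and "\<alpha> \<in> cylindric_shapes d L"
    and "x \<in> simplex d L"
    and "\<forall>i<d. int (x ! i) = \<alpha> (int i) - \<alpha> (int i + 1)"
    and "u = simplex_word x"
  shows "bij_betw (tableau_to_simplex_walk d L n \<alpha> x)
           (SCT d L n \<alpha>) (walks (simplex_digraph d L) n x)
       \<and> bij_betw (simplex_to_tasep_walk d 0)
           (walks (simplex_digraph d L) n x) (walks (tasep_digraph d L) n u)
       \<and> bij_betw (map tasep_to_necklace_arc)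
           (walks (tasep_digraph d L) n u) (walks (necklace_digraph d L) n (necklace u))"
  unfolding assms(6)
proof (intro conjI)
  show "bij_betw (tableau_to_simplex_walk d L n \<alpha> x)
      (SCT d L n \<alpha>) (walks (simplex_digraph d L) n x)"
    using assms(1-5) by (rule bij_betw_simplex_walks)
  show "bij_betw (simplex_to_tasep_walk d 0)
      (walks (simplex_digraph d L) n x) (walks (tasep_digraph d L) n (simplex_word x))"
    using bij_betw_tasep_walks[OF assms(4,2), of 0 n] by simp
  show "bij_betw (map tasep_to_necklace_arc) (walks (tasep_digraph d L) n (simplex_word x))
      (walks (necklace_digraph d L) n (necklace (simplex_word x)))"
    using simplex_word_states[OF assms(4)] by (rule bij_betw_necklace_walks)
qed

end
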